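(* Let $A \in \mathbb{C}^{n\times n}$, let $r_0 \in \mathbb{C}^n$ be nonzero, and put $v = r_0/\|r_0\|$. Let $Y_k \in \mathbb{C}^{n\times k}$ with $m+k<n$, and let $V_m$ be a matrix with $m$ orthonormal columns that form a basis of the Krylov subspace $\mathcal{K}_m(A,r_0)$ (so that $\mathcal{K}_m(A,r_0)$ is augmented by the range of $Y_k$). Let $z$ be in the range of $Y_k$, and let $q$ be a polynomial of degree $m$ with $q(0)=0$. Let $y := \|r_0\|\,q(A)v + Az$, and suppose that $r_s := r_0 - y$ is the optimal residual over the space $\mathrm{Range}(AV_m, AY_k)$. Then $$\frac{\|r_s\|^2}{\|r_0\|^2} \leq 1-\min_{w \in S_n} \frac{|w^* q(A) w|^2+\|w^* AY_k\|^2}{\|q(A)\|^2+\|AY_k\|_F^2},$$ where $S_n$ denotes the unit sphere in $\mathbb{C}^n$.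
   Context: $\|\cdot\|$ denotes the Euclidean norm on vectors (row or column) and the induced spectral norm on matrices; $\|\cdot\|_F$ is the Frobenius norm; ${}^*$ is the conjugate transpose. $\mathcal{K}_m(A,r_0)=\mathrm{span}\{r_0, Ar_0,\dots,A^{m-1}r_0\}$. $\mathrm{Range}(AV_m, AY_k)$ is the column space of the block matrix $(AV_m, AY_k)$. That $r_s = r_0-y$ is the optimal residual over this space means that $y$ belongs to it and $\|r_0-y\| = \min\{\|r_0-u\| : u\in \mathrm{Range}(AV_m, AY_k)\}$, i.e. $y$ is the orthogonal projection of $r_0$ onto this space. *)

theory Defs
  imports "HOL-Analysis.Analysis" "HOL-Computational_Algebra.Polynomial"
begin

(* The class-level power and multiplication on iterated vectors are not the matrix operations
   (multiplication there is componentwise), so powers and polynomials of matrices are built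
   from matrix multiplication. *)

definition matrix_power :: "'a::semiring_1^'n^'n \<Rightarrow> nat \<Rightarrow> 'a^'n^'n" where
  "matrix_power A i = ((**) A ^^ i) (mat 1)"

definition matrix_poly :: "'a::comm_ring_1 poly \<Rightarrow> 'a^'n^'n \<Rightarrow> 'a^'n^'n" where
  "matrix_poly q A = (\<Sum>i\<le>degree q. map_matrix (\<lambda>x. coeff q i * x) (matrix_power A i))"

definition vec_cnj :: "complex^'n \<Rightarrow> complex^'n" where
  "vec_cnj w = (\<chi> i. cnj (w $ i))"

definition conj_transpose :: "complex^'n^'m \<Rightarrow> complex^'m^'n" where
  "conj_transpose M = transpose (map_matrix cnj M)"

(* The scalar w^* u, conjugate-linear in w. *)
definition conj_dot :: "complex^'n \<Rightarrow> complex^'n \<Rightarrow> complex" where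
  "conj_dot w u = (\<Sum>i\<in>UNIV. cnj (w $ i) * u $ i)"

(* The vector norm of the library is Euclidean, so this is the induced 2-norm.
   The library norm of a matrix type is the Frobenius norm instead; see frobenius_norm_eq. *)
definition spectral_norm :: "complex^'n^'m \<Rightarrow> real" where
  "spectral_norm M = onorm (\<lambda>x. M *v x)"

definition frobenius_norm :: "complex^'n^'m \<Rightarrow> real" where
  "frobenius_norm M = sqrt (\<Sum>i\<in>UNIV. \<Sum>j\<in>UNIV. (cmod (M $ i $ j))\<^sup>2)"

lemma frobenius_norm_eq: "frobenius_norm M = norm M"
  by (simp add: frobenius_norm_def norm_vec_def L2_set_def sum_nonneg)

(* vec.span is the span over the scalar field (here the complex numbers), unlike span,
   which is the real span. *)
definition krylov :: "nat \<Rightarrow> 'a::field^'n^'n \<Rightarrow> 'a^'n \<Rightarrow> ('a^'n) set" where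
  "krylov m A r = vec.span ((\<lambda>i. matrix_power A i *v r) ` {..<m})"

definition block_cols :: "'a^'m^'n \<Rightarrow> 'a^'k^'n \<Rightarrow> 'a^('m + 'k)^'n" where
  "block_cols B C = (\<chi> i j. case j of Inl a \<Rightarrow> B $ i $ a | Inr b \<Rightarrow> C $ i $ b)"

definition column_space :: "'a::field^'m^'n \<Rightarrow> ('a^'n) set" where
  "column_space M = vec.span (columns M)"

definition orthonormal_columns :: "complex^'m^'n \<Rightarrow> bool" where
  "orthonormal_columns V \<longleftrightarrow> conj_transpose V ** V = mat 1"

(* With orthonormal columns, the indexed family of columns has no repetitions,
   so independence of the set of columns is independence of the family. *)
definition orthonormal_basis_matrix :: "complex^'m^'n \<Rightarrow> (complex^'n) set \<Rightarrow> bool" where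
  "orthonormal_basis_matrix V K \<longleftrightarrow>
     orthonormal_columns V \<and> vec.independent (columns V) \<and> vec.span (columns V) = K"

definition optimal_residual ::
  "complex^'n \<Rightarrow> complex^'n \<Rightarrow> (complex^'n) set \<Rightarrow> bool" where
  "optimal_residual r0 y U \<longleftrightarrow> y \<in> U \<and> (\<forall>u\<in>U. norm (r0 - y) \<le> norm (r0 - u))"

end

theory Submission
  imports Defs
begin

text \<open>
  Write \<open>U\<close> for the column space of \<open>(A V, A Y)\<close>. Optimality makes \<open>y\<close> the orthogonal projection
  of \<open>r0\<close> onto \<open>U\<close>, so by Pythagoras the left-hand side of the claim is
  \<open>1 - (norm y)\<^sup>2 / (norm r0)\<^sup>2\<close>, and the task is to bound \<open>norm y\<close> from below. A projection is at least as
  long as any component of \<open>r0\<close> in a direction of \<open>U\<close>: for \<open>u\<close> in \<open>U\<close> the scalars \<open>r0\<^sup>* u\<close> and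
  \<open>y\<^sup>* u\<close> agree, so Cauchy--Schwarz gives \<open>\<bar>r0\<^sup>* u\<bar> \<le> norm y * norm u\<close>
  (\<open>cmod_conj_dot_le_projection\<close>).

  This is applied to \<open>u = q(A) v\<close> and to every column of \<open>A Y\<close>. The vector \<open>q(A) v\<close> lies in \<open>U\<close>
  because \<open>q(0) = 0\<close> lets one factor \<open>A\<close> out of \<open>q(A)\<close>, and what remains has degree below \<open>m\<close>
  and so maps \<open>v\<close> into the Krylov space (\<open>matrix_poly_mult_vec_in_image_krylov\<close>).
  Scaled from \<open>r0\<close> to \<open>v\<close>, the squares of these inequalities add up to a bound on the numerator of
  the quotient at \<open>w = v\<close> by \<open>(norm y / norm r0)\<^sup>2\<close> times its denominator
  (\<open>numerator_le_denominator\<close>). The minimum over the unit sphere exists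
  by compactness and is at most the value at \<open>v\<close>.
\<close>

section \<open>The complex dot product\<close>

lemma conj_dot_diff_left: "conj_dot (a - b) u = conj_dot a u - conj_dot b u"
  by (simp add: conj_dot_def algebra_simps sum_subtractf)

lemma conj_dot_scaleR_left: "conj_dot (c *\<^sub>R a) u = of_real c * conj_dot a u"
  unfolding conj_dot_def sum_distrib_left
  by (intro sum.cong refl) (simp add: scaleR_conv_of_real[where 'a=complex] mult.assoc)

lemma Re_conj_dot: "Re (conj_dot a u) = a \<bullet> u"
  by (simp add: conj_dot_def inner_vec_def inner_complex_def)

text \<open>The real inner product only sees the real part; up to sign, the imaginary part is
  the real part for the vector rotated by \<open>\<i>\<close>.\<close>

lemma Im_conj_dot: "Im (conj_dot a u) = - (a \<bullet> (\<i> *s u))"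
  by (simp add: conj_dot_def inner_vec_def inner_complex_def sum_negf[symmetric] algebra_simps)

lemma cmod_conj_dot_le: "cmod (conj_dot a u) \<le> norm a * norm u"
proof -
  have "cmod (conj_dot a u) \<le> (\<Sum>i\<in>UNIV. \<bar>cmod (a $ i)\<bar> * \<bar>cmod (u $ i)\<bar>)"
    unfolding conj_dot_def by (rule order_trans[OF norm_sum]) (simp add: norm_mult)
  also have "\<dots> \<le> norm a * norm u"
    unfolding norm_vec_def by (rule L2_set_mult_ineq)
  finally show ?thesis .
qed

lemma vec_cnj_vector_matrix_mult: "(vec_cnj w v* M) $ j = conj_dot w (column j M)"
  by (simp add: vector_matrix_mult_def vec_cnj_def conj_dot_def column_def mult.commute)

lemma norm_vec_cnj_vector_matrix_mult:
  "(norm (vec_cnj w v* M))\<^sup>2 = (\<Sum>j\<in>UNIV. (cmod (conj_dot w (column j M)))\<^sup>2)"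
  by (simp add: norm_vec_def L2_set_def sum_nonneg vec_cnj_vector_matrix_mult)

lemma frobenius_norm_columns: "(frobenius_norm M)\<^sup>2 = (\<Sum>j\<in>UNIV. (norm (column j M))\<^sup>2)"
proof -
  have "(frobenius_norm M)\<^sup>2 = (\<Sum>i\<in>UNIV. \<Sum>j\<in>UNIV. (cmod (M $ i $ j))\<^sup>2)"
    by (simp add: frobenius_norm_def sum_nonneg)
  also have "\<dots> = (\<Sum>j\<in>UNIV. \<Sum>i\<in>UNIV. (cmod (M $ i $ j))\<^sup>2)"
    by (rule sum.swap)
  finally show ?thesis
    by (simp add: norm_vec_def L2_set_def sum_nonneg column_def)
qed

lemma norm_matrix_vector_mult_le_spectral:
  fixes M :: "complex^'n^'m"
  shows "norm (M *v x) \<le> spectral_norm M * norm x"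
proof -
  have "bounded_linear ((*v) M)"
    by (intro linear_conv_bounded_linear[THEN iffD1] matrix_vector_mul_linear)
  then show ?thesis
    unfolding spectral_norm_def by (rule onorm)
qed

section \<open>Optimal residuals\<close>

lemma vec_subspace_imp_real_subspace:
  fixes U :: "(complex^'n) set"
  assumes "vec.subspace U"
  shows "subspace U"
proof -
  have "c *\<^sub>R x = complex_of_real c *s x" for c :: real and x :: "complex^'n"
    by (simp add: vec_eq_iff) (simp add: scaleR_conv_of_real)
  with assms show ?thesis
    by (auto simp: subspace_def vec.subspace_def)
qed

text \<open>A closest point of a closed convex set is characterised by a real variational inequality.
  On a subspace it can be applied to \<open>u\<close> and \<open>- u\<close>, which gives real orthogonality, and on a complex
  subspace also to \<open>\<i> *s u\<close>, which takes care of the imaginary part.\<close>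

lemma optimal_residual_orthogonal:
  assumes opt: "optimal_residual r y U" and U: "vec.subspace U" and u: "u \<in> U"
  shows "conj_dot (r - y) u = 0"
proof -
  have U': "subspace U"
    using U by (rule vec_subspace_imp_real_subspace)
  have y: "y \<in> U" and best: "\<forall>w\<in>U. dist r y \<le> dist r w"
    using opt by (auto simp: optimal_residual_def dist_norm)
  have le: "(r - y) \<bullet> w \<le> 0" if "w \<in> U" for w
    using any_closest_point_dot[OF subspace_imp_convex[OF U'] closed_subspace[OF U'] y _ best,
        of "y + w"] subspace_add[OF U' y that] by simp
  have ort: "(r - y) \<bullet> w = 0" if "w \<in> U" for w
    using le[OF that] le[OF subspace_neg[OF U' that]] by simp
  have "\<i> *s u \<in> U"
    using U u by (simp add: vec.subspace_scale)
  then show ?thesis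
    using ort[of u] ort[of "\<i> *s u"] u
    by (intro complex_eqI) (simp_all add: Re_conj_dot Im_conj_dot)
qed

lemma cmod_conj_dot_le_projection:
  assumes "optimal_residual r y U" "vec.subspace U" "u \<in> U"
  shows "cmod (conj_dot r u) \<le> norm y * norm u"
  using optimal_residual_orthogonal[OF assms] cmod_conj_dot_le[of y u]
  by (simp add: conj_dot_diff_left)

lemma optimal_residual_Pythagoras:
  assumes "optimal_residual r y U" "vec.subspace U"
  shows "(norm r)\<^sup>2 = (norm (r - y))\<^sup>2 + (norm y)\<^sup>2"
proof -
  have "(r - y) \<bullet> y = 0"
    using optimal_residual_orthogonal[OF assms, of y] assms(1) Re_conj_dot[of "r - y" y]
    by (simp add: optimal_residual_def)
  then show ?thesis
    using norm_add_Pythagorean[of "r - y" y] by (simp add: orthogonal_def)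
qed

section \<open>The augmented search space\<close>

lemma column_matrix_mult: "column j (A ** B) = A *v column j B"
  by (simp add: column_def matrix_matrix_mult_def matrix_vector_mult_def vec_eq_iff)

lemma column_block_cols:
  "column (Inl a) (block_cols B C) = column a B"
  "column (Inr b) (block_cols B C) = column b C"
  by (simp_all add: column_def block_cols_def vec_eq_iff)

lemma column_block_cols_in_column_space:
  "column a B \<in> column_space (block_cols B C)"
  "column b C \<in> column_space (block_cols B C)"
proof -
  have "column j M \<in> column_space M" for j :: "'l::finite" and M :: "'a::field^'l^'n"
    unfolding column_space_def columns_def by (intro vec.span_base) blast
  from this[of "Inl a" "block_cols B C"] this[of "Inr b" "block_cols B C"]
  show "column a B \<in> column_space (block_cols B C)" "column b C \<in> column_space (block_cols B C)"
    by (simp_all add: column_block_cols)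
qed

lemma mult_vec_in_column_space_block_cols:
  fixes A :: "'a::field^'n^'n"
  assumes "x \<in> vec.span (columns V)"
  shows "A *v x \<in> column_space (block_cols (A ** V) C)"
  using assms
proof (induction rule: vec.span_induct)
  case base
  show ?case
    by (auto simp: vec.subspace_def column_space_def matrix_vector_right_distrib
        vector_scalar_commute intro: vec.span_zero vec.span_add vec.span_scale)
next
  case (step x)
  then obtain a where "x = column a V"
    by (auto simp: columns_def)
  then show ?case
    using column_block_cols_in_column_space(1)[of a "A ** V" C] by (simp add: column_matrix_mult)
qed

lemma matrix_poly_mult_vec:
  fixes A :: "'a::comm_ring_1^'n^'n"
  shows "matrix_poly q A *v x = (\<Sum>i\<le>degree q. coeff q i *s (matrix_power A i *v x))"
proof -
  have "map_matrix ((*) c) M *v x = c *s (M *v x)" for c and M :: "'a::comm_ring_1^'n^'n"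
    by (simp add: vec_eq_iff matrix_vector_mult_def map_matrix_def sum_distrib_left mult.assoc)
  moreover have "sum M I *v x = (\<Sum>i\<in>I. M i *v x)" for I and M :: "nat \<Rightarrow> 'a::comm_ring_1^'n^'n"
    by (induction I rule: infinite_finite_induct) (simp_all add: matrix_vector_mult_add_rdistrib)
  ultimately show ?thesis
    by (simp add: matrix_poly_def)
qed

text \<open>Without constant term, \<open>q(A) x = A (p(A) x)\<close> where \<open>p\<close> has the coefficients of \<open>q\<close> shifted
  down by one, so \<open>p(A) x\<close> only uses the powers of \<open>A\<close> that span the Krylov space.\<close>

lemma matrix_poly_mult_vec_in_image_krylov:
  assumes "poly q 0 = 0"
  shows "matrix_poly q A *v x \<in> (*v) A ` krylov (degree q) A x"
proof -
  let ?p = "\<Sum>i<degree q. coeff q (Suc i) *s (matrix_power A i *v x)"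
  have A_sum: "A *v sum g I = (\<Sum>i\<in>I. A *v g i)" for g and I :: "nat set"
    by (induction I rule: infinite_finite_induct) (simp_all add: matrix_vector_right_distrib)
  have "matrix_poly q A *v x = (\<Sum>i<degree q. coeff q (Suc i) *s (matrix_power A (Suc i) *v x))"
    using assms
    by (simp add: matrix_poly_mult_vec lessThan_Suc_atMost[symmetric] sum.lessThan_Suc_shift
        poly_0_coeff_0 del: sum.lessThan_Suc)
  also have "\<dots> = A *v ?p"
    by (simp add: A_sum matrix_power_def vector_scalar_commute
        matrix_vector_mul_assoc[symmetric])
  finally have "matrix_poly q A *v x = A *v ?p" .
  moreover have "?p \<in> krylov (degree q) A x"
    unfolding krylov_def by (intro vec.span_sum vec.span_scale vec.span_base) auto
  ultimately show ?thesis
    by blast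
qed

section \<open>The quotient and its minimum\<close>

text \<open>In the application, \<open>B\<close> stands for \<open>q(A)\<close> and \<open>C\<close> for \<open>A Y\<close>.\<close>

lemma continuous_on_field_of_values_quotient:
  fixes B :: "complex^'n^'n" and C :: "complex^'k^'n"
  shows "continuous_on S (\<lambda>w. ((cmod (conj_dot w (B *v w)))\<^sup>2 + (norm (vec_cnj w v* C))\<^sup>2) / d)"
  unfolding norm_vec_cnj_vector_matrix_mult divide_inverse conj_dot_def matrix_vector_mult_def
  by (intro continuous_intros)

text \<open>For a subspace \<open>U\<close>, the bound on \<open>conj_dot w u\<close> says that the projection of \<open>w\<close> onto \<open>U\<close> has
  norm at most \<open>c\<close>. Summing over columns is what turns the norms of the columns of \<open>C\<close> into a Frobenius norm.\<close>

lemma numerator_le_denominator: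
  fixes B :: "complex^'n^'n" and C :: "complex^'k^'n"
  assumes w: "norm w = 1"
    and bound: "\<And>u. u \<in> U \<Longrightarrow> cmod (conj_dot w u) \<le> c * norm u"
    and c: "0 \<le> c"
    and B: "B *v w \<in> U" and C: "\<And>j. column j C \<in> U"
  shows "(cmod (conj_dot w (B *v w)))\<^sup>2 + (norm (vec_cnj w v* C))\<^sup>2
    \<le> c\<^sup>2 * ((spectral_norm B)\<^sup>2 + (frobenius_norm C)\<^sup>2)"
proof -
  have "cmod (conj_dot w (B *v w)) \<le> c * norm (B *v w)"
    using B by (rule bound)
  also have "\<dots> \<le> c * spectral_norm B"
    using norm_matrix_vector_mult_le_spectral[of B w] w c by (simp add: mult_left_mono)
  finally have "(cmod (conj_dot w (B *v w)))\<^sup>2 \<le> (c * spectral_norm B)\<^sup>2"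
    by (rule power_mono) simp
  moreover have "(norm (vec_cnj w v* C))\<^sup>2 \<le> c\<^sup>2 * (frobenius_norm C)\<^sup>2"
    unfolding norm_vec_cnj_vector_matrix_mult frobenius_norm_columns sum_distrib_left
      power_mult_distrib[symmetric]
    by (intro sum_mono power_mono bound C) simp
  ultimately show ?thesis
    by (simp add: power_mult_distrib distrib_left)
qed

theorem theorem3:
  fixes A :: "complex^'n^'n"
    and r0 v z y rs :: "complex^'n"
    and Y :: "complex^'k^'n"
    and V :: "complex^'m^'n"
    and q :: "complex poly"
  assumes "r0 \<noteq> 0"
    and "v = (1 / norm r0) *\<^sub>R r0"
    and "CARD('m) + CARD('k) < CARD('n)"
    and "orthonormal_basis_matrix V (krylov CARD('m) A r0)"
    and "z \<in> column_space Y"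
    and "degree q = CARD('m)"
    and "poly q 0 = 0"
    and "y = norm r0 *\<^sub>R (matrix_poly q A *v v) + A *v z"
    and "rs = r0 - y"
    and "optimal_residual r0 y (column_space (block_cols (A ** V) (A ** Y)))"
  shows "let f = (\<lambda>w :: complex^'n.
              ((cmod (conj_dot w (matrix_poly q A *v w)))\<^sup>2 + (norm (vec_cnj w v* (A ** Y)))\<^sup>2)
              / ((spectral_norm (matrix_poly q A))\<^sup>2 + (frobenius_norm (A ** Y))\<^sup>2))
         in \<exists>w0. is_arg_min f (\<lambda>w. w \<in> sphere 0 1) w0 \<and>
              (norm rs)\<^sup>2 / (norm r0)\<^sup>2 \<le> 1 - f w0"
proof -
  define B where "B = matrix_poly q A"
  define C where "C = A ** Y"
  define d where "d = (spectral_norm B)\<^sup>2 + (frobenius_norm C)\<^sup>2"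
  define f where
    "f w = ((cmod (conj_dot w (B *v w)))\<^sup>2 + (norm (vec_cnj w v* C))\<^sup>2) / d" for w
  define U where "U = column_space (block_cols (A ** V) C)"
  have opt: "optimal_residual r0 y U"
    using assms(10) by (simp add: U_def C_def)
  have U: "vec.subspace U"
    by (simp add: U_def column_space_def vec.subspace_span)
  have B_in: "B *v r0 \<in> U"
  proof -
    obtain x where x: "B *v r0 = A *v x" "x \<in> krylov CARD('m) A r0"
      using matrix_poly_mult_vec_in_image_krylov[OF assms(7), of A r0] assms(6)
      by (auto simp: B_def)
    then have "x \<in> vec.span (columns V)"
      using assms(4) by (simp add: orthonormal_basis_matrix_def)
    then show ?thesis
      unfolding U_def x(1) by (rule mult_vec_in_column_space_block_cols)
  qed
  have C_in: "column j C \<in> U" for j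
    unfolding U_def by (rule column_block_cols_in_column_space)
  have r0: "norm r0 > 0"
    using assms(1) by simp
  have v: "v \<in> sphere 0 1"
    using assms(1,2) by simp
  have "sphere 0 1 \<noteq> ({} :: (complex^'n) set)"
    using v by blast
  then obtain w0 where w0: "w0 \<in> sphere 0 1" and min: "\<And>w. w \<in> sphere 0 1 \<Longrightarrow> f w0 \<le> f w"
    using continuous_attains_inf[OF compact_sphere _ continuous_on_field_of_values_quotient]
    unfolding f_def by meson
  have "B *v v = (1 / norm r0) *\<^sub>R (B *v r0)"
    unfolding assms(2) by (rule linear_cmul[OF matrix_vector_mul_linear])
  then have Bv: "B *v v \<in> U"
    using subspace_scale[OF vec_subspace_imp_real_subspace[OF U] B_in] by simp
  have "cmod (conj_dot v u) \<le> norm y / norm r0 * norm u" if "u \<in> U" for u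
    using cmod_conj_dot_le_projection[OF opt U that] r0
    by (simp add: assms(2) conj_dot_scaleR_left norm_divide divide_right_mono)
  then have num: "(cmod (conj_dot v (B *v v)))\<^sup>2 + (norm (vec_cnj v v* C))\<^sup>2
      \<le> (norm y)\<^sup>2 / (norm r0)\<^sup>2 * d"
    unfolding d_def power_divide[symmetric]
    using v Bv C_in by (intro numerator_le_denominator[of v U]) auto
  have "f v \<le> (norm y)\<^sup>2 / (norm r0)\<^sup>2"
  proof (cases "d = 0")
    \<comment> \<open>Division by zero makes the quotient vanish identically when both \<open>q(A)\<close> and \<open>A Y\<close> are zero.\<close>
    case True
    then show ?thesis by (simp add: f_def)
  next
    case False
    then have "d > 0"
      unfolding d_def by (simp add: add_nonneg_pos sum_power2_gt_zero_iff)
    then show ?thesis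
      using num by (simp add: f_def pos_divide_le_eq)
  qed
  moreover have "(norm rs)\<^sup>2 / (norm r0)\<^sup>2 = 1 - (norm y)\<^sup>2 / (norm r0)\<^sup>2"
    using optimal_residual_Pythagoras[OF opt U] r0 unfolding assms(9) by (simp add: field_simps)
  ultimately have "(norm rs)\<^sup>2 / (norm r0)\<^sup>2 \<le> 1 - f w0"
    using min[OF v] by simp
  moreover have "is_arg_min f (\<lambda>w. w \<in> sphere 0 1) w0"
    using w0 min by (auto simp: is_arg_min_linorder)
  ultimately show ?thesis
    unfolding Let_def f_def d_def B_def C_def by blast
qed

end
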